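(* Let $L$ be convex concave, let $\lambda>0$, and let $L'(x,y)=L(x,y)+\frac{\lambda}{2}\|x\|^2-\frac{\lambda}{2}\|y\|^2$. Let $(p,q)$ be the unique equilibrium of $L'$ and let $(\theta(0),\phi(0))$ be an initialization that is safe for $(p,q)$. Let $(\theta(t),\phi(t))$ be the solution, started at $(\theta(0),\phi(0))$, of the gradient descent ascent dynamics for $L'$, and put $$r(t)=\|F(\theta(t))-p\|^2+\|G(\phi(t))-q\|^2 .$$ Then there are initialization dependent constants $c_0,c_1>0$ such that $r(t)\le c_0\exp(-\lambda c_1 t)$ for all $t\ge0$.
   Context: Setting: $n,m,n_1,\dots,n_n,m_1,\dots,m_m$ are positive integers, $N=\sum_i n_i$, $M=\sum_j m_j$; $f_i:\mathbb{R}^{n_i}\to\mathbb{R}$, $g_j:\mathbb{R}^{m_j}\to\mathbb{R}$ and $L:\mathbb{R}^n\times\mathbb{R}^m\to\mathbb{R}$, $(x,y)\mapsto L(x,y)$, are $C^2$. Write $\theta=(\theta_1,\dots,\theta_n)\in\mathbb{R}^N$, $\theta_i\in\mathbb{R}^{n_i}$, $\phi=(\phi_1,\dots,\phi_m)\in\mathbb{R}^M$, $\phi_j\in\mathbb{R}^{m_j}$, and $F(\theta)=(f_1(\theta_1),\dots,f_n(\theta_n))$, $G(\phi)=(g_1(\phi_1),\dots,g_m(\phi_m))$. The norm is Euclidean. Convex concave: $L(\cdot,y)$ is convex for every $y\in\mathbb{R}^m$ and $L(x,\cdot)$ is concave for every $x\in\mathbb{R}^n$. An equilibrium of $L'$ is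 a pair $(p,q)$ with $L'(p,y)\le L'(p,q)\le L'(x,q)$ for all $x\in\mathbb{R}^n,y\in\mathbb{R}^m$. Gradient descent ascent (GDA) dynamics for $L'$: $\dot\theta_i=-\nabla f_i(\theta_i)\,\frac{\partial L'}{\partial x_i}(F(\theta),G(\phi))$, $\dot\phi_j=\nabla g_j(\phi_j)\,\frac{\partial L'}{\partial y_j}(F(\theta),G(\phi))$. Gradient ascent image: for $k:\mathbb{R}^d\to\mathbb{R}$ of class $C^2$ and $x_0\in\mathbb{R}^d$, let $x:\mathbb{R}\to\mathbb{R}^d$ be the solution of $\dot x=\nabla k(x)$, $x(0)=x_0$; $\operatorname{Im}_k(x_0)$ is the image of $k\circ x:\mathbb{R}\to\mathbb{R}$. The gradient ascent trajectories of the $f_i,g_j$ are assumed to be defined for all times $t\in\mathbb{R}$. Safe: $(\theta(0),\phi(0))$ is safe for $(p,q)$ if no $\theta_i(0)$ is a stationary point of $f_i$, no $\phi_j(0)$ is a stationary point of $g_j$, and $p_i\in\operatorname{Im}_{f_i}(\theta_i(0))$, $q_j\in\operatorname{Im}_{g_j}(\phi_j(0))$ for all $i,j$. *)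

theory Defs
  imports "HOL-Analysis.Analysis"
begin

definition C2 :: "('a::euclidean_space \<Rightarrow> real) \<Rightarrow> bool" where
  "C2 f \<longleftrightarrow> (\<exists>(g :: 'a \<Rightarrow> 'a) (H :: 'a \<Rightarrow> 'a \<Rightarrow>\<^sub>L 'a).
      (\<forall>x. GDERIV f x :> g x) \<and>
      (\<forall>x. (g has_derivative blinfun_apply (H x)) (at x)) \<and>
      continuous_on UNIV H)"

definition grad :: "('a::euclidean_space \<Rightarrow> real) \<Rightarrow> 'a \<Rightarrow> 'a" where
  "grad f x = (THE D. GDERIV f x :> D)"

definition partial_fst ::
  "((real^'n) \<times> (real^'m) \<Rightarrow> real) \<Rightarrow> 'n \<Rightarrow> (real^'n) \<times> (real^'m) \<Rightarrow> real" where
  "partial_fst L i z = deriv (\<lambda>s. L (fst z + s *\<^sub>R axis i 1, snd z)) 0"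

definition partial_snd ::
  "((real^'n) \<times> (real^'m) \<Rightarrow> real) \<Rightarrow> 'm \<Rightarrow> (real^'n) \<times> (real^'m) \<Rightarrow> real" where
  "partial_snd L j z = deriv (\<lambda>s. L (fst z, snd z + s *\<^sub>R axis j 1)) 0"

text \<open>
  A vector made of blocks of different sizes, \<open>\<theta> = (\<theta>\<^sub>1, \<dots>, \<theta>\<^sub>n)\<close> with \<open>\<theta>\<^sub>i\<close> in a space of
  dimension \<open>n\<^sub>i\<close>, is a single vector \<open>\<theta> :: real^'k\<close> together with a surjection \<open>b :: 'k \<Rightarrow> 'i\<close>
  that assigns each coordinate to its block, so \<open>n\<^sub>i = card (b -` {i})\<close> is positive and
  \<open>CARD('k)\<close> is the sum of the \<open>n\<^sub>i\<close>. The space of the \<open>i\<close>-th block is identified with the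
  coordinate subspace of vectors that vanish at the coordinates outside block \<open>i\<close>, and
  \<open>block b i \<theta>\<close> is \<open>\<theta>\<^sub>i\<close>.
\<close>

definition block :: "('k \<Rightarrow> 'i) \<Rightarrow> 'i \<Rightarrow> real^'k \<Rightarrow> real^'k" where
  "block b i x = (\<chi> k. if b k = i then x $ k else 0)"

text \<open>
  A function of the \<open>i\<close>-th block is represented by its composition with the projection
  onto that block. Hence its gradient lies in the subspace of block \<open>i\<close>, and so does every gradient
  ascent trajectory started there.
\<close>

definition depends_on_block :: "('k \<Rightarrow> 'i) \<Rightarrow> 'i \<Rightarrow> (real^'k \<Rightarrow> real) \<Rightarrow> bool" where
  "depends_on_block b i f \<longleftrightarrow> (\<forall>x. f x = f (block b i x))"

definition blockwise :: "('k \<Rightarrow> 'i) \<Rightarrow> ('i \<Rightarrow> real^'k \<Rightarrow> real) \<Rightarrow> real^'k \<Rightarrow> real^'i" where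
  "blockwise b f x = (\<chi> i. f i (block b i x))"

definition convex_concave :: "((real^'n) \<times> (real^'m) \<Rightarrow> real) \<Rightarrow> bool" where
  "convex_concave L \<longleftrightarrow>
     (\<forall>y. convex_on UNIV (\<lambda>x. L (x, y))) \<and> (\<forall>x. concave_on UNIV (\<lambda>y. L (x, y)))"

definition equilibrium ::
  "((real^'n) \<times> (real^'m) \<Rightarrow> real) \<Rightarrow> real^'n \<Rightarrow> real^'m \<Rightarrow> bool" where
  "equilibrium L p q \<longleftrightarrow> (\<forall>x y. L (p, y) \<le> L (p, q) \<and> L (p, q) \<le> L (x, q))"

definition regularized ::
  "real \<Rightarrow> ((real^'n) \<times> (real^'m) \<Rightarrow> real) \<Rightarrow> (real^'n) \<times> (real^'m) \<Rightarrow> real" where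
  "regularized lam L z = L z + lam / 2 * (norm (fst z))\<^sup>2 - lam / 2 * (norm (snd z))\<^sup>2"

definition gradient_ascent ::
  "('a::euclidean_space \<Rightarrow> real) \<Rightarrow> 'a \<Rightarrow> (real \<Rightarrow> 'a) \<Rightarrow> bool" where
  "gradient_ascent k x0 x \<longleftrightarrow>
     x 0 = x0 \<and> (\<forall>t. (x has_vector_derivative grad k (x t)) (at t))"

definition ascent_image :: "('a::euclidean_space \<Rightarrow> real) \<Rightarrow> 'a \<Rightarrow> real set" where
  "ascent_image k x0 = range (k \<circ> (THE x. gradient_ascent k x0 x))"

definition safe ::
  "('k \<Rightarrow> 'n) \<Rightarrow> ('l \<Rightarrow> 'm) \<Rightarrow> ('n \<Rightarrow> real^'k \<Rightarrow> real) \<Rightarrow> ('m \<Rightarrow> real^'l \<Rightarrow> real) \<Rightarrow>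
   real^'n \<Rightarrow> real^'m \<Rightarrow> real^'k \<Rightarrow> real^'l \<Rightarrow> bool" where
  "safe a b f g p q \<theta>0 \<phi>0 \<longleftrightarrow>
     (\<forall>i. grad (f i) (block a i \<theta>0) \<noteq> 0 \<and> p $ i \<in> ascent_image (f i) (block a i \<theta>0)) \<and>
     (\<forall>j. grad (g j) (block b j \<phi>0) \<noteq> 0 \<and> q $ j \<in> ascent_image (g j) (block b j \<phi>0))"

definition gda_solution ::
  "('k \<Rightarrow> 'n) \<Rightarrow> ('l \<Rightarrow> 'm) \<Rightarrow> ('n \<Rightarrow> real^'k \<Rightarrow> real) \<Rightarrow> ('m \<Rightarrow> real^'l \<Rightarrow> real) \<Rightarrow>
   ((real^'n) \<times> (real^'m) \<Rightarrow> real) \<Rightarrow> (real \<Rightarrow> real^'k) \<Rightarrow> (real \<Rightarrow> real^'l) \<Rightarrow> bool" where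
  "gda_solution a b f g L \<theta> \<phi> \<longleftrightarrow>
     (\<forall>t\<ge>0. \<forall>i. ((\<lambda>s. block a i (\<theta> s)) has_vector_derivative
        - (partial_fst L i (blockwise a f (\<theta> t), blockwise b g (\<phi> t))
           *\<^sub>R grad (f i) (block a i (\<theta> t)))) (at t within {0..})) \<and>
     (\<forall>t\<ge>0. \<forall>j. ((\<lambda>s. block b j (\<phi> s)) has_vector_derivative
        partial_snd L j (blockwise a f (\<theta> t), blockwise b g (\<phi> t))
           *\<^sub>R grad (g j) (block b j (\<phi> t))) (at t within {0..}))"

end

theory Submission
  imports Defs
begin

text \<open>
  Each block moves along a fixed curve. The equation for \<open>\<theta>\<^sub>i\<close> is the gradient equation of
  \<open>f\<^sub>i\<close> with a scalar speed \<open>c\<^sub>i(t) = - \<partial>L'/\<partial>x\<^sub>i\<close>, so \<open>\<theta>\<^sub>i(t) = x\<^sub>i(s\<^sub>i(t))\<close>, where \<open>x\<^sub>i\<close> is the gradient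
  ascent trajectory through \<open>\<theta>\<^sub>i(0)\<close> and \<open>s\<^sub>i' = c\<^sub>i\<close> (\<open>gradient_curve_reparametrized\<close>). Along that
  trajectory \<open>h\<^sub>i(s) = f\<^sub>i(x\<^sub>i(s))\<close> has derivative \<open>\<parallel>\<nabla>f\<^sub>i(x\<^sub>i(s))\<parallel>\<^sup>2\<close>, which is positive because the start is
  not stationary, and safety says that \<open>h\<^sub>i\<close> takes the value \<open>p\<^sub>i\<close> at some \<open>r\<^sub>i\<close>.

  Let \<open>W\<^sub>i\<close> be the antiderivative of \<open>h\<^sub>i - p\<^sub>i\<close> that vanishes at \<open>r\<^sub>i\<close>. It is convex and nonnegative, and
  \<open>d/dt W\<^sub>i(s\<^sub>i(t)) = (f\<^sub>i(\<theta>\<^sub>i) - p\<^sub>i) c\<^sub>i(t)\<close>: the unknown factor \<open>\<parallel>\<nabla>f\<^sub>i\<parallel>\<^sup>2\<close>, which distorts the dynamics of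
  \<open>F(\<theta>)\<close>, cancels. Hence the sum \<open>w\<close> of these potentials over both players satisfies
  \<open>w' = - (F - p) \<bullet> \<nabla>\<^sub>xL' + (G - q) \<bullet> \<nabla>\<^sub>yL'\<close>, as for plain gradient descent ascent on \<open>L'\<close>, and
  \<open>w' \<le> - \<lambda>/2 r\<close> by convexity, concavity and the equilibrium property
  (\<open>regularized_saddle_gradient_monotone\<close>).

  So \<open>w\<close> never exceeds its initial value, which confines every \<open>s\<^sub>i(t)\<close> to a sublevel set of \<open>W\<^sub>i\<close>. Such a
  set is bounded, so \<open>h\<^sub>i'\<close> lies between two positive constants on an interval containing it, and there
  \<open>\<mu> W\<^sub>i \<le> (h\<^sub>i - p\<^sub>i)\<^sup>2 \<le> M W\<^sub>i\<close> (\<open>potential_comparable_to_square\<close>). Therefore \<open>w' \<le> - (\<lambda> \<mu> / 2) w\<close>, and the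
  exponential decay of \<open>w\<close> passes to \<open>r \<le> M w\<close>. All constants come from the trajectories through the
  initial point, before a solution of the dynamics is chosen.
\<close>

section \<open>Gradient trajectories\<close>

text \<open>
  Gronwall's inequality in differential form, with \<open>K\<close> of either sign: the derivative of
  \<open>w t * exp (- K * t)\<close> is nonpositive.
\<close>

lemma exp_bound_of_deriv_le:
  fixes w :: "real \<Rightarrow> real"
  assumes "0 \<le> T"
    and dw: "\<And>t. t \<in> {0..T} \<Longrightarrow> (w has_real_derivative w' t) (at t within {0..T})"
    and le: "\<And>t. t \<in> {0..T} \<Longrightarrow> w' t \<le> K * w t"
  shows "w T \<le> w 0 * exp (K * T)"
proof -
  have "\<exists>\<xi>\<in>{0..T}. w T * exp (- K * T) - w 0 * exp (- K * 0)
      = (\<lambda>d. d * ((w' \<xi> - K * w \<xi>) * exp (- K * \<xi>))) (T - 0)"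
    using \<open>0 \<le> T\<close>
  proof (rule mvt_very_simple)
    fix t assume "0 \<le> t" "t \<le> T"
    then have t: "t \<in> {0..T}" by simp
    have "((\<lambda>t. w t * exp (- K * t)) has_real_derivative (w' t - K * w t) * exp (- K * t))
        (at t within {0..T})"
      by (auto intro!: derivative_eq_intros dw[OF t] simp: algebra_simps)
    then show "((\<lambda>t. w t * exp (- K * t)) has_derivative
        (\<lambda>d. d * ((w' t - K * w t) * exp (- K * t)))) (at t within {0..T})"
      unfolding has_field_derivative_def by (rule has_derivative_eq_rhs) (simp add: fun_eq_iff)
  qed
  then obtain \<xi> where \<xi>: "\<xi> \<in> {0..T}"
    and eq: "w T * exp (- K * T) - w 0 = T * ((w' \<xi> - K * w \<xi>) * exp (- K * \<xi>))"
    by auto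
  have "T * ((w' \<xi> - K * w \<xi>) * exp (- K * \<xi>)) \<le> 0"
    using le[OF \<xi>] \<open>0 \<le> T\<close> by (intro mult_nonneg_nonpos mult_nonpos_nonneg) auto
  then have "w T * exp (- K * T) \<le> w 0" using eq by simp
  then have "w T * exp (- K * T) * exp (K * T) \<le> w 0 * exp (K * T)"
    by (rule mult_right_mono) simp
  then show ?thesis by (simp add: mult.assoc flip: exp_add)
qed

text \<open>
  The two solutions stay in a common ball up to time \<open>T\<close>. On it \<open>V\<close> is Lipschitz, since its derivative is
  continuous, so the squared distance of the solutions satisfies a linear differential inequality
  with initial value 0. The scalar factor \<open>c\<close> admits time changes and, with \<open>c = - 1\<close>, time reversal.
\<close>

lemma rescaled_ode_unique:
  fixes V :: "'a::euclidean_space \<Rightarrow> 'a" and H :: "'a \<Rightarrow> 'a \<Rightarrow>\<^sub>L 'a"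
  assumes dV: "\<And>x. (V has_derivative blinfun_apply (H x)) (at x)"
    and H: "continuous_on UNIV H" and c: "continuous_on {0..} c"
    and dx: "\<And>t. t \<ge> 0 \<Longrightarrow> (x has_vector_derivative c t *\<^sub>R V (x t)) (at t within {0..})"
    and dy: "\<And>t. t \<ge> 0 \<Longrightarrow> (y has_vector_derivative c t *\<^sub>R V (y t)) (at t within {0..})"
    and "x 0 = y 0" and "T \<ge> 0"
  shows "x T = y T"
proof -
  define I where "I = {0..T}"
  have I: "compact I" "I \<subseteq> {0..}" by (auto simp: I_def)
  have dxI: "(x has_vector_derivative c t *\<^sub>R V (x t)) (at t within I)" if "t \<in> I" for t
    using dx[of t] I that by (auto intro: has_vector_derivative_within_subset)
  have dyI: "(y has_vector_derivative c t *\<^sub>R V (y t)) (at t within I)" if "t \<in> I" for t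
    using dy[of t] I that by (auto intro: has_vector_derivative_within_subset)
  have cx: "continuous_on I x" "continuous_on I y"
    using has_vector_derivative_continuous[OF dxI] has_vector_derivative_continuous[OF dyI]
    by (simp_all add: continuous_on_eq_continuous_within)
  have "bounded (x ` I \<union> y ` I)"
    using I(1) cx by (simp add: compact_imp_bounded compact_continuous_image)
  then obtain R where R: "x ` I \<union> y ` I \<subseteq> cball 0 R"
    unfolding bounded_iff by (auto simp: subset_iff)
  have "bounded (H ` cball 0 R)"
    using H by (meson compact_cball compact_continuous_image compact_imp_bounded
        continuous_on_subset top_greatest)
  then obtain B where B: "\<forall>z \<in> cball 0 R. norm (H z) \<le> B"
    unfolding bounded_iff by blast
  have "bounded (c ` I)"
    using c I by (meson compact_continuous_image compact_imp_bounded continuous_on_subset)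
  then obtain C where C: "\<And>t. t \<in> I \<Longrightarrow> \<bar>c t\<bar> \<le> C"
    unfolding bounded_iff by auto
  have lip: "norm (V (x t) - V (y t)) \<le> B * norm (x t - y t)" if "t \<in> I" for t
  proof (rule differentiable_bound[where S = "cball 0 R" and f' = "\<lambda>z. blinfun_apply (H z)"])
    show "(V has_derivative blinfun_apply (H z)) (at z within cball 0 R)" for z
      using dV by (rule has_derivative_at_withinI)
    show "onorm (blinfun_apply (H z)) \<le> B" if "z \<in> cball 0 R" for z
      using B that by (simp add: norm_blinfun.rep_eq)
  qed (use R that in auto)
  define w where "w t = (x t - y t) \<bullet> (x t - y t)" for t
  have "w T \<le> w 0 * exp ((2 * C * B) * T)"
  proof (rule exp_bound_of_deriv_le[OF \<open>T \<ge> 0\<close>])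
    fix t assume "t \<in> {0..T}"
    then have t: "t \<in> I" by (simp add: I_def)
    have "((\<lambda>t. x t - y t) has_vector_derivative c t *\<^sub>R (V (x t) - V (y t))) (at t within I)"
      using has_vector_derivative_diff[OF dxI[OF t] dyI[OF t]] by (simp add: scaleR_right_diff_distrib)
    then have "(w has_derivative (\<lambda>d. (x t - y t) \<bullet> (d *\<^sub>R c t *\<^sub>R (V (x t) - V (y t)))
        + (d *\<^sub>R c t *\<^sub>R (V (x t) - V (y t))) \<bullet> (x t - y t))) (at t within I)"
      unfolding w_def has_vector_derivative_def by (intro has_derivative_inner)
    then show "(w has_real_derivative 2 * c t * ((x t - y t) \<bullet> (V (x t) - V (y t)))) (at t within {0..T})"
      unfolding has_field_derivative_def I_def[symmetric]
      by (rule has_derivative_eq_rhs) (auto simp: fun_eq_iff algebra_simps inner_commute)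
    have "2 * c t * ((x t - y t) \<bullet> (V (x t) - V (y t)))
        \<le> 2 * (\<bar>c t\<bar> * \<bar>(x t - y t) \<bullet> (V (x t) - V (y t))\<bar>)"
      by (metis abs_ge_self abs_mult mult.assoc mult_left_mono zero_le_numeral)
    also have "\<dots> \<le> 2 * (C * (norm (x t - y t) * (B * norm (x t - y t))))"
    proof -
      have "\<bar>(x t - y t) \<bullet> (V (x t) - V (y t))\<bar> \<le> norm (x t - y t) * (B * norm (x t - y t))"
        using Cauchy_Schwarz_ineq2[of "x t - y t"] lip[OF t]
        by (meson mult_left_mono norm_ge_zero order_trans)
      moreover have "0 \<le> C" using C[OF t] by linarith
      ultimately show ?thesis using C[OF t] by (intro mult_left_mono mult_mono) auto
    qed
    also have "\<dots> = (2 * C * B) * w t"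
      by (simp add: w_def dot_square_norm power2_eq_square)
    finally show "2 * c t * ((x t - y t) \<bullet> (V (x t) - V (y t))) \<le> (2 * C * B) * w t" .
  qed
  then have "w T \<le> 0" using \<open>x 0 = y 0\<close> by (simp add: w_def)
  then show ?thesis by (simp add: w_def dot_square_norm)
qed

lemma GDERIV_grad:
  assumes "GDERIV k x :> D"
  shows "GDERIV k x :> grad k x" "grad k x = D"
proof -
  have "D' = D" if "GDERIV k x :> D'" for D'
    using has_derivative_unique[OF that[unfolded gderiv_def] assms[unfolded gderiv_def]]
    by (metis inner_commute vector_eq_ldot)
  then show "grad k x = D"
    unfolding grad_def using assms by (intro the_equality)
  then show "GDERIV k x :> grad k x" using assms by simp
qed

lemma C2_GDERIV: "C2 k \<Longrightarrow> GDERIV k x :> grad k x"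
  unfolding C2_def using GDERIV_grad(1) by blast

lemma C2_grad_derivative:
  assumes "C2 k"
  shows "\<exists>H :: 'a::euclidean_space \<Rightarrow> 'a \<Rightarrow>\<^sub>L 'a.
    (\<forall>x. (grad k has_derivative blinfun_apply (H x)) (at x)) \<and> continuous_on UNIV H"
proof -
  obtain D and H :: "'a \<Rightarrow> 'a \<Rightarrow>\<^sub>L 'a" where
    D: "\<forall>x. GDERIV k x :> D x" "\<forall>x. (D has_derivative blinfun_apply (H x)) (at x)"
    and H: "continuous_on UNIV H"
    using assms unfolding C2_def by auto
  moreover have "grad k = D" using GDERIV_grad(2) D(1) by blast
  ultimately show ?thesis by blast
qed

text \<open>
  Uniqueness in both time directions: the part before \<open>r\<close> becomes a forward solution of the reversed
  field.
\<close>

lemma gradient_ascent_unique_from: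
  assumes "C2 k"
    and dx: "\<And>t. (x has_vector_derivative grad k (x t)) (at t)"
    and dy: "\<And>t. (y has_vector_derivative grad k (y t)) (at t)"
    and "x r = y r"
  shows "x = y"
proof
  fix t
  obtain H where H: "\<And>x. (grad k has_derivative blinfun_apply (H x)) (at x)" "continuous_on UNIV H"
    using C2_grad_derivative[OF \<open>C2 k\<close>] by auto
  define e where "e = (if r \<le> t then 1 else - 1 :: real)"
  have shift: "((\<lambda>s. z (r + e * s)) has_vector_derivative e *\<^sub>R grad k (z (r + e * s)))
      (at s within {0..})"
    if "\<And>t. (z has_vector_derivative grad k (z t)) (at t)" for z s
  proof -
    have "((\<lambda>s. r + e * s) has_real_derivative e) (at s within {0..})"
      by (auto intro!: derivative_eq_intros)
    then show ?thesis
      using vector_diff_chain_within[of "\<lambda>s. r + e * s" e s "{0..}" z]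
        has_vector_derivative_at_within[OF that]
      by (simp add: has_real_derivative_iff_has_vector_derivative o_def)
  qed
  have "x (r + e * \<bar>t - r\<bar>) = y (r + e * \<bar>t - r\<bar>)"
    by (rule rescaled_ode_unique[where c = "\<lambda>_. e" and x = "\<lambda>s. x (r + e * s)"
          and y = "\<lambda>s. y (r + e * s)", OF H])
      (use shift[OF dx] shift[OF dy] \<open>x r = y r\<close> in auto)
  then show "x t = y t" by (auto simp: e_def split: if_splits)
qed

lemma gradient_ascent_the:
  assumes "C2 k" "gradient_ascent k z0 x"
  shows "(THE x. gradient_ascent k z0 x) = x"
proof (rule the_equality)
  show "y = x" if "gradient_ascent k z0 y" for y
    using assms that
    by (intro gradient_ascent_unique_from[where x = y and y = x and r = 0]) (auto simp: gradient_ascent_def)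
qed fact

text \<open>
  A trajectory that reached a stationary point would coincide with the constant solution there.
\<close>

lemma gradient_ascent_nonstationary:
  assumes "C2 k" "gradient_ascent k z0 x" "grad k z0 \<noteq> 0"
  shows "grad k (x t) \<noteq> 0"
proof
  assume "grad k (x t) = 0"
  then have "x = (\<lambda>_. x t)"
    using assms
    by (intro gradient_ascent_unique_from[OF \<open>C2 k\<close>, where r = t])
      (auto simp: gradient_ascent_def)
  then have "x 0 = x t" by metis
  with assms \<open>grad k (x t) = 0\<close> show False by (simp add: gradient_ascent_def)
qed

lemma GDERIV_along_curve:
  assumes "GDERIV k (z t) :> D" "(z has_vector_derivative z') (at t within S)"
  shows "((\<lambda>t. k (z t)) has_real_derivative z' \<bullet> D) (at t within S)"
  using has_derivative_compose[OF assms(2)[unfolded has_vector_derivative_def]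
      assms(1)[unfolded gderiv_def]]
  unfolding has_field_derivative_def by (rule has_derivative_eq_rhs) (simp add: fun_eq_iff)

lemma continuous_antiderivative:
  fixes u :: "real \<Rightarrow> real"
  assumes "continuous_on UNIV u"
  shows "\<exists>U. (\<forall>s. (U has_real_derivative u s) (at s)) \<and> U r = 0"
proof -
  have "\<exists>U. \<forall>s. (- \<infinity>) < ereal s \<longrightarrow> ereal s < \<infinity> \<longrightarrow> (U has_vector_derivative u s) (at s)"
    using assms by (intro einterval_antiderivative) (auto simp: continuous_on_eq_continuous_at)
  then obtain U where U: "\<And>s. (U has_real_derivative u s) (at s)"
    by (auto simp: has_real_derivative_iff_has_vector_derivative)
  have "((\<lambda>s. U s - U r) has_real_derivative u s) (at s)" for s
    by (auto intro!: derivative_eq_intros U)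
  then show ?thesis by (intro exI[of _ "\<lambda>s. U s - U r"]) simp
qed

section \<open>The potential of one coordinate\<close>

text \<open>
  The antiderivative of a monotone function is convex, hence lies above its tangents.
\<close>

lemma mono_antiderivative_above_tangent:
  fixes h W :: "real \<Rightarrow> real"
  assumes "mono h" and dW: "\<And>s. (W has_real_derivative h s - v) (at s)"
  shows "W c + (h c - v) * (s - c) \<le> W s"
proof (cases c s rule: linorder_cases)
  case less
  then obtain \<xi> where "c < \<xi>" "\<xi> < s" and eq: "W s - W c = (s - c) * (h \<xi> - v)"
    using MVT2[of c s W "\<lambda>s. h s - v"] dW by auto
  then have "(s - c) * (h c - v) \<le> (s - c) * (h \<xi> - v)"
    using monoD[OF \<open>mono h\<close>, of c \<xi>] by (intro mult_left_mono) simp_all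
  with eq show ?thesis by (simp add: mult.commute)
next
  case greater
  then obtain \<xi> where "s < \<xi>" "\<xi> < c" and eq: "W c - W s = (c - s) * (h \<xi> - v)"
    using MVT2[of s c W "\<lambda>s. h s - v"] dW by auto
  then have "(c - s) * (h \<xi> - v) \<le> (c - s) * (h c - v)"
    using monoD[OF \<open>mono h\<close>, of \<xi> c] by (intro mult_left_mono) simp_all
  with eq show ?thesis by (simp add: algebra_simps)
qed simp

text \<open>
  Strict monotonicity of \<open>h\<close> makes \<open>W\<close> grow at least linearly away from \<open>r\<close>, so the sublevel set of \<open>E\<close>
  lies in a compact interval \<open>{A..B}\<close>, where \<open>m \<le> u \<le> M\<close> for some \<open>m > 0\<close>. There \<open>h s - h r\<close> is comparable to
  \<open>s - r\<close>, and tangents to \<open>W\<close> bound \<open>W s\<close> from both sides by multiples of \<open>(s - r)\<^sup>2\<close>.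
\<close>

lemma potential_comparable_to_square:
  fixes h u W :: "real \<Rightarrow> real"
  assumes dh: "\<And>s. (h has_real_derivative u s) (at s)"
    and u: "continuous_on UNIV u" "\<And>s. u s > 0"
    and dW: "\<And>s. (W has_real_derivative h s - h r) (at s)" and "W r = 0"
  shows "\<exists>\<mu>>0. \<exists>M>0. \<forall>s. W s \<le> E \<longrightarrow>
    \<mu> * W s \<le> (h s - h r)\<^sup>2 \<and> (h s - h r)\<^sup>2 \<le> M * W s"
proof -
  have less: "h s < h s'" if "s < s'" for s s'
    using that
  proof (rule DERIV_pos_imp_increasing)
    show "\<exists>y. (h has_real_derivative y) (at t) \<and> 0 < y" for t
      using dh[of t] u(2)[of t] by auto
  qed
  then have "mono h" by (metis less_le monoI nle_le)
  note tangent = mono_antiderivative_above_tangent[OF this dW]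
  have W_nonneg: "0 \<le> W s" for s using tangent[of r s] \<open>W r = 0\<close> by simp
  \<comment> \<open>The points at which the tangents to \<open>W\<close> at \<open>r - 1\<close> and \<open>r + 1\<close>, lowered to height 0 there, reach \<open>\<bar>E\<bar>\<close>.\<close>
  define A where "A = r - 1 - \<bar>E\<bar> / (h r - h (r - 1))"
  define B where "B = r + 1 + \<bar>E\<bar> / (h (r + 1) - h r)"
  have pos: "h (r + 1) - h r > 0" "h r - h (r - 1) > 0" using less by auto
  have r: "r \<in> {A..B}" using pos by (auto simp: A_def B_def add_increasing2 diff_le_eq)
  have sublevel: "s \<in> {A..B}" if "W s \<le> E" for s
  proof -
    have "(h (r + 1) - h r) * (s - (r + 1)) \<le> \<bar>E\<bar>"
      using tangent[of "r + 1" s] W_nonneg[of "r + 1"] that by linarith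
    moreover have "(h r - h (r - 1)) * (r - 1 - s) \<le> \<bar>E\<bar>"
      using tangent[of "r - 1" s] W_nonneg[of "r - 1"] that
      by (simp add: algebra_simps)
    ultimately show ?thesis
      using pos by (simp add: A_def B_def field_simps)
  qed
  have "compact {A..B}" "{A..B} \<noteq> {}" "continuous_on {A..B} u"
    using r u(1) continuous_on_subset by auto
  then obtain s0 s1 where "s0 \<in> {A..B}" "s1 \<in> {A..B}"
    and u_bounds: "\<And>s. s \<in> {A..B} \<Longrightarrow> u s0 \<le> u s" "\<And>s. s \<in> {A..B} \<Longrightarrow> u s \<le> u s1"
    by (metis continuous_attains_inf continuous_attains_sup)
  define m M where "m = u s0" and "M = u s1"
  have "m > 0" "M > 0" using u(2) by (simp_all add: m_def M_def)
  have mvt: "\<exists>k. m \<le> k \<and> k \<le> M \<and> h s - h r = k * (s - r)" if s: "s \<in> {A..B}" for s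
  proof (cases s r rule: linorder_cases)
    case less
    then obtain \<xi> where "s < \<xi>" "\<xi> < r" and eq: "h r - h s = (r - s) * u \<xi>"
      using MVT2[of s r h u] dh by auto
    then have "\<xi> \<in> {A..B}" using s r by auto
    then show ?thesis
      using eq u_bounds[of \<xi>] by (intro exI[of _ "u \<xi>"]) (auto simp: m_def M_def algebra_simps)
  next
    case greater
    then obtain \<xi> where "r < \<xi>" "\<xi> < s" and eq: "h s - h r = (s - r) * u \<xi>"
      using MVT2[of r s h u] dh by auto
    then have "\<xi> \<in> {A..B}" using s r by auto
    then show ?thesis
      using eq u_bounds[of \<xi>] by (intro exI[of _ "u \<xi>"]) (auto simp: m_def M_def algebra_simps)
  next
    case equal
    then show ?thesis using u_bounds(2)[of s0] \<open>s0 \<in> {A..B}\<close> by (auto simp: m_def M_def)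
  qed
  have "m * W s \<le> (h s - h r)\<^sup>2 \<and> (h s - h r)\<^sup>2 \<le> (4 * M\<^sup>2 / m) * W s" if "W s \<le> E" for s
  proof
    have s: "s \<in> {A..B}" using sublevel[OF that] .
    obtain k where k: "m \<le> k" "k \<le> M" and hk: "h s - h r = k * (s - r)" using mvt[OF s] by auto
    \<comment> \<open>The tangent at \<open>s\<close>, evaluated at \<open>r\<close>, where \<open>W\<close> vanishes.\<close>
    have "W s \<le> (h s - h r) * (s - r)" using tangent[of s r] \<open>W r = 0\<close> by (simp add: algebra_simps)
    then have "m * W s \<le> m * (k * (s - r)\<^sup>2)"
      using \<open>m > 0\<close> hk by (intro mult_left_mono) (auto simp: power2_eq_square)
    also have "\<dots> \<le> k * (k * (s - r)\<^sup>2)"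
      using k \<open>m > 0\<close> by (intro mult_right_mono) auto
    also have "\<dots> = (h s - h r)\<^sup>2" using hk by (simp add: power2_eq_square)
    finally show "m * W s \<le> (h s - h r)\<^sup>2" .
    \<comment> \<open>The tangent at \<open>r\<close> is horizontal; the one at the midpoint gives the quadratic lower bound.\<close>
    define c where "c = (s + r) / 2"
    have "c \<in> {A..B}" using s r by (auto simp: c_def)
    then obtain k' where k': "m \<le> k'" and hc: "h c - h r = k' * (c - r)" using mvt by blast
    have half: "c - r = (s - r) / 2" "s - c = (s - r) / 2" by (simp_all add: c_def field_simps)
    have "m * ((s - r)\<^sup>2 / 4) \<le> k' * ((s - r)\<^sup>2 / 4)" using k' by (intro mult_right_mono) auto
    also have "\<dots> = (h c - h r) * (s - c)" unfolding hc half by (simp add: power2_eq_square)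
    also have "\<dots> \<le> W s" using tangent[of c s] W_nonneg[of c] by linarith
    finally have "(s - r)\<^sup>2 \<le> (4 / m) * W s" using \<open>m > 0\<close> by (simp add: field_simps)
    moreover have "(h s - h r)\<^sup>2 \<le> M\<^sup>2 * (s - r)\<^sup>2"
      unfolding hk power_mult_distrib using k \<open>m > 0\<close> by (intro mult_right_mono power_mono) auto
    ultimately have "(h s - h r)\<^sup>2 \<le> M\<^sup>2 * ((4 / m) * W s)"
      by (meson mult_left_mono order_trans zero_le_power2)
    then show "(h s - h r)\<^sup>2 \<le> (4 * M\<^sup>2 / m) * W s" by (simp add: mult_ac)
  qed
  then show ?thesis using \<open>m > 0\<close> \<open>M > 0\<close> by (intro exI[of _ m] conjI exI[of _ "4 * M\<^sup>2 / m"]) auto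
qed

text \<open>
  With \<open>s\<close> an antiderivative of \<open>c\<close>, the curve \<open>x \<circ> s\<close> solves the same rescaled equation as \<open>z\<close>.
\<close>

lemma gradient_curve_reparametrized:
  fixes k :: "'a::euclidean_space \<Rightarrow> real"
  assumes "C2 k" and x: "gradient_ascent k z0 x" and c: "continuous_on {0..} c"
    and "z 0 = z0"
    and dz: "\<And>t. t \<ge> 0 \<Longrightarrow> (z has_vector_derivative c t *\<^sub>R grad k (z t)) (at t within {0..})"
  shows "\<exists>s. s 0 = 0 \<and>
    (\<forall>t\<ge>0. (s has_real_derivative c t) (at t within {0..}) \<and> z t = x (s t))"
proof -
  \<comment> \<open>Constant extension of \<open>c\<close> to negative times, so that an antiderivative on all of \<open>\<real>\<close> exists.\<close>
  have "continuous_on UNIV (\<lambda>t. c (max 0 t))"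
    by (rule continuous_on_compose2[OF c]) (auto intro!: continuous_intros)
  then obtain s where ds: "\<And>t. (s has_real_derivative c (max 0 t)) (at t)" and "s 0 = 0"
    using continuous_antiderivative[where r = 0] by blast
  then have ds': "(s has_real_derivative c t) (at t within {0..})" if "t \<ge> 0" for t
    using that ds[of t] by (simp add: has_field_derivative_at_within max_absorb2)
  have dxs: "((\<lambda>t. x (s t)) has_vector_derivative c t *\<^sub>R grad k (x (s t))) (at t within {0..})"
    if "t \<ge> 0" for t
  proof -
    have "(x has_vector_derivative grad k (x (s t))) (at (s t) within s ` {0..})"
      using x by (auto simp: gradient_ascent_def intro: has_vector_derivative_at_within)
    with ds'[OF that] show ?thesis
      using vector_diff_chain_within[of s "c t" t "{0..}" x]
      by (simp add: has_real_derivative_iff_has_vector_derivative o_def)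
  qed
  obtain H where H: "\<And>x. (grad k has_derivative blinfun_apply (H x)) (at x)"
    "continuous_on UNIV H"
    using C2_grad_derivative[OF \<open>C2 k\<close>] by auto
  have start: "z 0 = x (s 0)" using x \<open>z 0 = z0\<close> \<open>s 0 = 0\<close> by (simp add: gradient_ascent_def)
  have "z t = x (s t)" if "t \<ge> 0" for t
    by (rule rescaled_ode_unique[OF H c dz dxs start that])
  with ds' \<open>s 0 = 0\<close> show ?thesis by (intro exI[of _ s]) simp
qed

section \<open>Energies and their decay\<close>

text \<open>
  \<open>w\<close> serves as a Lyapunov function for the deviation \<open>dev\<close>. The two comparisons are required only
  below the level \<open>E\<close>, because suitable constants \<open>\<mu>\<close> and \<open>M\<close> depend on the sublevel set.
\<close>

definition energy_for ::
  "real \<Rightarrow> real \<Rightarrow> real \<Rightarrow> (real \<Rightarrow> real) \<Rightarrow> (real \<Rightarrow> real) \<Rightarrow> (real \<Rightarrow> real) \<Rightarrow> bool" where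
  "energy_for E \<mu> M rate dev w \<longleftrightarrow>
     (\<forall>t\<ge>0. (w has_real_derivative rate t) (at t within {0..}) \<and> 0 \<le> w t \<and>
       (w t \<le> E \<longrightarrow> \<mu> * w t \<le> dev t \<and> dev t \<le> M * w t))"

lemma energy_for_weaken:
  assumes "energy_for E \<mu> M rate dev w" and "\<mu>' \<le> \<mu>" and "M \<le> M'"
  shows "energy_for E \<mu>' M' rate dev w"
  unfolding energy_for_def
proof (intro allI impI conjI)
  fix t :: real assume "t \<ge> 0"
  with assms(1) have w: "(w has_real_derivative rate t) (at t within {0..})" "0 \<le> w t"
    and bounds: "w t \<le> E \<Longrightarrow> \<mu> * w t \<le> dev t \<and> dev t \<le> M * w t"
    unfolding energy_for_def by auto
  show "(w has_real_derivative rate t) (at t within {0..})" "0 \<le> w t" by (fact w)+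
  assume "w t \<le> E"
  with bounds mult_right_mono[OF assms(2) w(2)] mult_right_mono[OF assms(3) w(2)]
  show "\<mu>' * w t \<le> dev t" "dev t \<le> M' * w t" by linarith+
qed

text \<open>
  Since all summands are nonnegative, each of them is below the level \<open>E\<close> whenever the sum is.
\<close>

lemma energy_for_sum:
  fixes w :: "'i::finite \<Rightarrow> real \<Rightarrow> real"
  assumes "\<And>i. energy_for E \<mu> M (rate i) (dev i) (w i)"
  shows "energy_for E \<mu> M (\<lambda>t. \<Sum>i\<in>UNIV. rate i t) (\<lambda>t. \<Sum>i\<in>UNIV. dev i t) (\<lambda>t. \<Sum>i\<in>UNIV. w i t)"
  unfolding energy_for_def
proof (intro allI impI conjI)
  fix t :: real assume "t \<ge> 0"
  have dw: "(w i has_real_derivative rate i t) (at t within {0..})" and nonneg: "0 \<le> w i t"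
    and bounds: "w i t \<le> E \<Longrightarrow> \<mu> * w i t \<le> dev i t \<and> dev i t \<le> M * w i t" for i
    using assms \<open>t \<ge> 0\<close> unfolding energy_for_def by blast+
  show "((\<lambda>t. \<Sum>i\<in>UNIV. w i t) has_real_derivative (\<Sum>i\<in>UNIV. rate i t)) (at t within {0..})"
    by (intro DERIV_sum dw)
  show "0 \<le> (\<Sum>i\<in>UNIV. w i t)" by (intro sum_nonneg nonneg)
  assume le: "(\<Sum>i\<in>UNIV. w i t) \<le> E"
  have "w i t \<le> (\<Sum>i\<in>UNIV. w i t)" for i
    using nonneg by (intro member_le_sum) auto
  then have "w i t \<le> E" for i using le order_trans by blast
  then show "\<mu> * (\<Sum>i\<in>UNIV. w i t) \<le> (\<Sum>i\<in>UNIV. dev i t)"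
    "(\<Sum>i\<in>UNIV. dev i t) \<le> M * (\<Sum>i\<in>UNIV. w i t)"
    unfolding sum_distrib_left using bounds by (auto intro!: sum_mono)
qed

lemma energy_for_add:
  assumes "energy_for E \<mu> M rate dev w" and "energy_for E \<mu>' M' rate' dev' w'"
  shows "energy_for E (min \<mu> \<mu>') (max M M') (\<lambda>t. rate t + rate' t) (\<lambda>t. dev t + dev' t) (\<lambda>t. w t + w' t)"
proof -
  have "energy_for E (min \<mu> \<mu>') (max M M') (if i then rate else rate') (if i then dev else dev')
      (if i then w else w')" for i
    using assms by (auto intro: energy_for_weaken)
  then show ?thesis
    using energy_for_sum[where rate = "\<lambda>i. if i then rate else rate'"
        and dev = "\<lambda>i. if i then dev else dev'" and w = "\<lambda>i. if i then w else w'"]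
    by (simp add: UNIV_bool add.commute)
qed

text \<open>
  The argument runs in two rounds. First \<open>w\<close> is merely nonincreasing, which keeps it below \<open>E\<close>; only then
  is the comparison of \<open>w\<close> with \<open>dev\<close> available, and it turns the bound on the rate into
  \<open>w' \<le> - \<kappa> \<mu> w\<close>.
\<close>

lemma exponential_decay_of_energy:
  assumes en: "energy_for E \<mu> M rate dev w" and "w 0 \<le> E" and "M \<ge> 0" and "\<kappa> \<ge> 0"
    and rate: "\<And>t. t \<ge> 0 \<Longrightarrow> rate t \<le> - \<kappa> * dev t"
    and dev: "\<And>t. t \<ge> 0 \<Longrightarrow> 0 \<le> dev t" and "T \<ge> 0"
  shows "dev T \<le> M * w 0 * exp (- \<kappa> * \<mu> * T)"
proof -
  have dw: "(w has_real_derivative rate t) (at t within {0..s})" if "t \<in> {0..s}" for s t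
  proof -
    have "(w has_real_derivative rate t) (at t within {0..})"
      using en that unfolding energy_for_def by auto
    then show ?thesis by (rule DERIV_subset) auto
  qed
  have sublevel: "w s \<le> E" if "s \<ge> 0" for s
  proof -
    have "w s \<le> w 0 * exp (0 * s)"
    proof (rule exp_bound_of_deriv_le[OF that dw])
      fix t assume "t \<in> {0..s}"
      then show "rate t \<le> 0 * w t"
        using rate[of t] mult_nonneg_nonneg[OF \<open>\<kappa> \<ge> 0\<close> dev[of t]] by auto
    qed
    with \<open>w 0 \<le> E\<close> show ?thesis by simp
  qed
  have "w T \<le> w 0 * exp ((- \<kappa> * \<mu>) * T)"
  proof (rule exp_bound_of_deriv_le[OF \<open>T \<ge> 0\<close> dw])
    fix t assume t: "t \<in> {0..T}"
    then have "\<mu> * w t \<le> dev t" using en sublevel unfolding energy_for_def by simp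
    then have "\<kappa> * (\<mu> * w t) \<le> \<kappa> * dev t" using \<open>\<kappa> \<ge> 0\<close> by (rule mult_left_mono)
    then show "rate t \<le> (- \<kappa> * \<mu>) * w t" using rate[of t] t by simp
  qed
  then have "M * w T \<le> M * (w 0 * exp ((- \<kappa> * \<mu>) * T))" using \<open>M \<ge> 0\<close> by (rule mult_left_mono)
  moreover have "dev T \<le> M * w T" using en sublevel \<open>T \<ge> 0\<close> unfolding energy_for_def by simp
  ultimately show ?thesis by (simp add: mult.assoc)
qed

text \<open>
  All curves \<open>z\<close> from \<open>z0\<close> that follow the gradient of \<open>k\<close> at some continuous speed \<open>c\<close> carry an energy with
  the same constants and the same initial value \<open>e\<close>. In the game \<open>c\<close> is a partial derivative evaluated along
  the unknown solution, so the constants must not depend on it.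
\<close>

definition driven_energy ::
  "('a::euclidean_space \<Rightarrow> real) \<Rightarrow> 'a \<Rightarrow> real \<Rightarrow> real \<Rightarrow> real \<Rightarrow> real \<Rightarrow> real \<Rightarrow> bool" where
  "driven_energy k z0 v e E \<mu> M \<longleftrightarrow> (\<forall>c z.
     continuous_on {0..} c \<and> z 0 = z0 \<and>
     (\<forall>t\<ge>0. (z has_vector_derivative c t *\<^sub>R grad k (z t)) (at t within {0..})) \<longrightarrow>
     (\<exists>w. w 0 = e \<and> energy_for E \<mu> M (\<lambda>t. (k (z t) - v) * c t) (\<lambda>t. (k (z t) - v)\<^sup>2) w))"

text \<open>
  The energy is \<open>W (s t)\<close>, where \<open>W\<close> is the antiderivative of \<open>k (x s) - v\<close> with zero and minimum at the
  parameter \<open>r\<close> where \<open>k \<circ> x\<close> takes the value \<open>v\<close>, and \<open>s\<close> is the time change that carries \<open>x\<close> to \<open>z\<close>.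
  The initial value is \<open>W 0\<close>, since time changes start at 0.
\<close>

lemma safe_coordinate_potential:
  fixes k :: "'a::euclidean_space \<Rightarrow> real"
  assumes "C2 k" and "gradient_ascent k z0 x" and "grad k z0 \<noteq> 0" and "v \<in> ascent_image k z0"
  shows "\<exists>e\<ge>0. \<forall>E. \<exists>\<mu>>0. \<exists>M>0. driven_energy k z0 v e E \<mu> M"
proof -
  define h where "h s = k (x s)" for s
  define u where "u s = grad k (x s) \<bullet> grad k (x s)" for s
  have dx: "\<And>s. (x has_vector_derivative grad k (x s)) (at s)"
    using assms(2) by (simp add: gradient_ascent_def)
  have dh: "(h has_real_derivative u s) (at s)" for s
    unfolding h_def u_def by (rule GDERIV_along_curve[OF C2_GDERIV[OF \<open>C2 k\<close>] dx])
  have u_pos: "u s > 0" for s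
    using gradient_ascent_nonstationary[OF assms(1-3)] by (simp add: u_def)
  have "isCont (grad k) z" for z
    using C2_grad_derivative[OF \<open>C2 k\<close>] has_derivative_continuous by blast
  then have "continuous_on UNIV (grad k)" by (simp add: continuous_on_eq_continuous_at)
  moreover have "continuous_on UNIV x"
    using dx has_vector_derivative_continuous by (metis continuous_at_imp_continuous_on)
  ultimately have u_cont: "continuous_on UNIV u"
    unfolding u_def by (intro continuous_intros continuous_on_compose2[of UNIV "grad k" UNIV x]) auto
  obtain r where r: "v = h r"
    using assms(4) unfolding ascent_image_def gradient_ascent_the[OF assms(1,2)] h_def by auto
  have "continuous_on UNIV (\<lambda>s. h s - v)"
    using dh by (intro continuous_intros continuous_at_imp_continuous_on) (blast dest: DERIV_isCont)
  then obtain W where dW: "\<And>s. (W has_real_derivative h s - v) (at s)" and "W r = 0"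
    using continuous_antiderivative[where r = r] by blast
  have "mono h"
  proof (rule monoI)
    show "h s \<le> h s'" if "s \<le> s'" for s s'
      using that dh u_pos less_imp_le
      by (metis DERIV_nonneg_imp_nondecreasing)
  qed
  then have W_nonneg: "0 \<le> W s" for s
    using mono_antiderivative_above_tangent[OF \<open>mono h\<close> dW, of r s] \<open>W r = 0\<close> r by simp
  have "\<exists>\<mu>>0. \<exists>M>0. driven_energy k z0 v (W 0) E \<mu> M" for E
  proof -
    obtain \<mu> M where "\<mu> > 0" "M > 0" and bounds: "\<forall>s. W s \<le> E \<longrightarrow>
        \<mu> * W s \<le> (h s - v)\<^sup>2 \<and> (h s - v)\<^sup>2 \<le> M * W s"
      using potential_comparable_to_square[OF dh u_cont u_pos dW[unfolded r] \<open>W r = 0\<close>, of E]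
      unfolding r by auto
    moreover have "\<exists>w. w 0 = W 0 \<and>
        energy_for E \<mu> M (\<lambda>t. (k (z t) - v) * c t) (\<lambda>t. (k (z t) - v)\<^sup>2) w"
      if c: "continuous_on {0..} c" and z: "z 0 = z0"
        "\<And>t. t \<ge> 0 \<Longrightarrow> (z has_vector_derivative c t *\<^sub>R grad k (z t)) (at t within {0..})" for c z
    proof -
      obtain s where "s 0 = 0"
        and s: "\<forall>t\<ge>0. (s has_real_derivative c t) (at t within {0..}) \<and> z t = x (s t)"
        using gradient_curve_reparametrized[OF assms(1,2) c z] by auto
      have "((\<lambda>t. W (s t)) has_real_derivative (k (z t) - v) * c t) (at t within {0..})"
        if "t \<ge> 0" for t
        using DERIV_chain2[OF dW, of s "c t" t "{0..}"] s that by (simp add: h_def)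
      then show ?thesis
        using \<open>s 0 = 0\<close> W_nonneg bounds s
        by (intro exI[of _ "\<lambda>t. W (s t)"]) (simp add: h_def energy_for_def)
    qed
    ultimately show ?thesis
      unfolding driven_energy_def by (intro exI[of _ \<mu>] conjI exI[of _ M] allI impI) simp_all
  qed
  then show ?thesis using W_nonneg by (intro exI[of _ "W 0"]) simp
qed

lemma driven_energy_weaken:
  assumes "driven_energy k z0 v e E \<mu> M" and "\<mu>' \<le> \<mu>" and "M \<le> M'"
  shows "driven_energy k z0 v e E \<mu>' M'"
  unfolding driven_energy_def
proof (intro allI impI, goal_cases)
  case (1 c z)
  then obtain w where "w 0 = e"
    and "energy_for E \<mu> M (\<lambda>t. (k (z t) - v) * c t) (\<lambda>t. (k (z t) - v)\<^sup>2) w"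
    using assms(1)[unfolded driven_energy_def, rule_format, of c z] by auto
  then show ?case using energy_for_weaken[OF _ assms(2,3)] by (intro exI[of _ w]) simp
qed

text \<open>
  The initial values \<open>e\<close> are chosen before the level \<open>E\<close>, so that \<open>E\<close> can later be taken to be the total initial
  energy of both players.
\<close>

lemma safe_player_potentials:
  fixes k :: "'i::finite \<Rightarrow> 'a::euclidean_space \<Rightarrow> real"
  assumes "\<And>i. C2 (k i)" and "\<And>i. \<exists>x. gradient_ascent (k i) (z0 i) x"
    and "\<And>i. grad (k i) (z0 i) \<noteq> 0 \<and> v i \<in> ascent_image (k i) (z0 i)"
  shows "\<exists>e. (\<forall>i. 0 \<le> e i) \<and>
    (\<forall>E. \<exists>\<mu>>0. \<exists>M>0. \<forall>i. driven_energy (k i) (z0 i) (v i) (e i) E \<mu> M)"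
proof -
  have "\<exists>e\<ge>0. \<forall>E. \<exists>\<mu>>0. \<exists>M>0. driven_energy (k i) (z0 i) (v i) e E \<mu> M" for i
    using safe_coordinate_potential[OF assms(1)] assms(2,3) by blast
  then obtain e where e: "\<forall>i. 0 \<le> e i"
    and "\<forall>i E. \<exists>\<mu>>0. \<exists>M>0. driven_energy (k i) (z0 i) (v i) (e i) E \<mu> M"
    by metis
  then obtain \<mu> M where \<mu>M: "\<And>i E. \<mu> i E > (0::real)" "\<And>i E. M i E > (0::real)"
    and en: "\<And>i E. driven_energy (k i) (z0 i) (v i) (e i) E (\<mu> i E) (M i E)"
    by metis
  have "\<exists>\<mu>0>0. \<exists>M0>0. \<forall>i. driven_energy (k i) (z0 i) (v i) (e i) E \<mu>0 M0" for E
  proof (intro exI conjI allI)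
    show "Min (range (\<lambda>i. \<mu> i E)) > 0" using \<mu>M(1) by simp
    have "M i E \<le> Max (range (\<lambda>i. M i E))" for i by simp
    then show "Max (range (\<lambda>i. M i E)) > 0" using \<mu>M(2) less_le_trans by blast
    show "driven_energy (k i) (z0 i) (v i) (e i) E (Min (range (\<lambda>i. \<mu> i E)))
        (Max (range (\<lambda>i. M i E)))" for i
      using en by (rule driven_energy_weaken) simp_all
  qed
  with e show ?thesis by blast
qed

lemma driven_energy_sum:
  fixes k :: "'i::finite \<Rightarrow> 'a::euclidean_space \<Rightarrow> real"
  assumes en: "\<forall>i. driven_energy (k i) (z0 i) (v i) (e i) E \<mu> M"
    and c: "\<And>i. continuous_on {0..} (c i)" and "\<And>i. z i 0 = z0 i"
    and dz: "\<And>i t. t \<ge> 0 \<Longrightarrow>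
      (z i has_vector_derivative c i t *\<^sub>R grad (k i) (z i t)) (at t within {0..})"
  shows "\<exists>w. w 0 = (\<Sum>i\<in>UNIV. e i) \<and>
    energy_for E \<mu> M (\<lambda>t. \<Sum>i\<in>UNIV. (k i (z i t) - v i) * c i t)
      (\<lambda>t. \<Sum>i\<in>UNIV. (k i (z i t) - v i)\<^sup>2) w"
proof -
  have "\<exists>w. w 0 = e i \<and>
      energy_for E \<mu> M (\<lambda>t. (k i (z i t) - v i) * c i t) (\<lambda>t. (k i (z i t) - v i)\<^sup>2) w" for i
    using en[unfolded driven_energy_def, rule_format, of "c i" "z i" i] c assms(3) dz by simp
  then obtain w where w: "\<And>i. w i 0 = e i" and en: "\<And>i.
      energy_for E \<mu> M (\<lambda>t. (k i (z i t) - v i) * c i t) (\<lambda>t. (k i (z i t) - v i)\<^sup>2) (w i)"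
    by metis
  show ?thesis
    using energy_for_sum[where w = w and rate = "\<lambda>i t. (k i (z i t) - v i) * c i t"
        and dev = "\<lambda>i t. (k i (z i t) - v i)\<^sup>2", OF en] w
    by (intro exI[of _ "\<lambda>t. \<Sum>i\<in>UNIV. w i t"]) simp
qed

section \<open>Monotonicity of the regularized game\<close>

lemma convex_on_above_tangent_plane:
  fixes k :: "'a::euclidean_space \<Rightarrow> real"
  assumes "convex_on UNIV k" and D: "GDERIV k x :> D"
  shows "k x + D \<bullet> (y - x) \<le> k y"
proof -
  define \<phi> where "\<phi> s = k (x + s *\<^sub>R (y - x))" for s
  have "convex_on UNIV \<phi>"
  proof (rule convex_onI)
    fix t s s' :: real assume "0 < t" "t < 1"
    have "x + ((1 - t) *\<^sub>R s + t *\<^sub>R s') *\<^sub>R (y - x)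
        = (1 - t) *\<^sub>R (x + s *\<^sub>R (y - x)) + t *\<^sub>R (x + s' *\<^sub>R (y - x))"
      by (simp add: algebra_simps)
    then show "\<phi> ((1 - t) *\<^sub>R s + t *\<^sub>R s') \<le> (1 - t) * \<phi> s + t * \<phi> s'"
      unfolding \<phi>_def using convex_onD[OF assms(1), of t] \<open>0 < t\<close> \<open>t < 1\<close> by simp
  qed simp
  moreover have "(\<phi> has_real_derivative (y - x) \<bullet> D) (at 0)"
    unfolding \<phi>_def
  proof (rule GDERIV_along_curve)
    show "((\<lambda>s. x + s *\<^sub>R (y - x)) has_vector_derivative y - x) (at 0)"
      by (auto intro!: derivative_eq_intros simp: has_vector_derivative_def)
  qed (use D in simp)
  ultimately have "((y - x) \<bullet> D) * (1 - 0) \<le> \<phi> 1 - \<phi> 0"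
    by (intro convex_on_imp_above_tangent[of UNIV]) auto
  then show ?thesis by (simp add: \<phi>_def inner_commute)
qed

lemma GDERIV_slices:
  fixes L :: "'a::euclidean_space \<times> 'b::euclidean_space \<Rightarrow> real"
  assumes "GDERIV L (x, y) :> D"
  shows "GDERIV (\<lambda>x. L (x, y)) x :> fst D" and "GDERIV (\<lambda>y. L (x, y)) y :> snd D"
proof -
  have "((\<lambda>x. (x, y)) has_derivative (\<lambda>h. (h, 0))) (at x)"
    "((\<lambda>y. (x, y)) has_derivative (\<lambda>h. (0, h))) (at y)"
    by (auto intro!: derivative_eq_intros)
  from this[THEN has_derivative_compose, OF assms[unfolded gderiv_def]]
  show "GDERIV (\<lambda>x. L (x, y)) x :> fst D" "GDERIV (\<lambda>y. L (x, y)) y :> snd D"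
    by (simp_all add: gderiv_def inner_prod_def)
qed

lemma partials_regularized:
  assumes "GDERIV L z :> D"
  shows "partial_fst (regularized lam L) i z = fst D $ i + lam * fst z $ i"
    and "partial_snd (regularized lam L) j z = snd D $ j - lam * snd z $ j"
proof -
  obtain x y where z: "z = (x, y)" by (cases z)
  note D = GDERIV_slices[OF assms[unfolded z]]
  have axis: "((\<lambda>s. v + s *\<^sub>R axis i 1) has_vector_derivative axis i 1) (at 0)"
    for v :: "real^'c::finite" and i
    by (auto intro!: derivative_eq_intros simp: has_vector_derivative_def)
  have along: "((\<lambda>s. k (v + s *\<^sub>R axis i 1)) has_real_derivative D $ i) (at 0)"
    if "GDERIV k v :> D" for k and v D :: "real^'c::finite" and i
    using GDERIV_along_curve[of k "\<lambda>s. v + s *\<^sub>R axis i 1" 0 D, OF _ axis] that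
    by (simp add: inner_axis')
  have "GDERIV (\<lambda>v. (norm v)\<^sup>2) v :> 2 *\<^sub>R v" for v :: "real^'c::finite"
    unfolding gderiv_def power2_norm_eq_inner
    by (auto intro!: derivative_eq_intros simp: inner_commute)
  note sq = along[OF this]
  have "((\<lambda>s. regularized lam L (x + s *\<^sub>R axis i 1, y)) has_real_derivative
      fst D $ i + lam * x $ i) (at 0)"
    unfolding regularized_def fst_conv snd_conv
    by (rule derivative_eq_intros along[OF D(1)] sq refl)+ simp
  then show "partial_fst (regularized lam L) i z = fst D $ i + lam * fst z $ i"
    unfolding partial_fst_def z by (auto intro: DERIV_imp_deriv)
  have "((\<lambda>s. regularized lam L (x, y + s *\<^sub>R axis j 1)) has_real_derivative
      snd D $ j - lam * y $ j) (at 0)"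
    unfolding regularized_def fst_conv snd_conv
    by (rule derivative_eq_intros along[OF D(2)] sq refl)+ simp
  then show "partial_snd (regularized lam L) j z = snd D $ j - lam * snd z $ j"
    unfolding partial_snd_def z by (auto intro: DERIV_imp_deriv)
qed

text \<open>
  Convexity bounds \<open>L (p, y)\<close> and concavity bounds \<open>L (x, q)\<close> by the linearizations of \<open>L\<close> at \<open>(x, y)\<close>. The
  quadratic terms of \<open>L' = regularized lam L\<close> are expanded exactly, which leaves \<open>lam / 2\<close> times the squared
  distances and the difference \<open>L' (x, q) - L' (p, y)\<close>; the equilibrium property makes the latter
  nonnegative.
\<close>

lemma regularized_saddle_gradient_monotone:
  assumes "C2 L" and "convex_concave L" and "0 \<le> lam" and "equilibrium (regularized lam L) p q"
  shows "lam / 2 * ((norm (x - p))\<^sup>2 + (norm (y - q))\<^sup>2)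
    \<le> (\<Sum>i\<in>UNIV. (x $ i - p $ i) * partial_fst (regularized lam L) i (x, y))
      - (\<Sum>j\<in>UNIV. (y $ j - q $ j) * partial_snd (regularized lam L) j (x, y))"
proof -
  define D where "D = grad L (x, y)"
  have D: "GDERIV L (x, y) :> D" unfolding D_def by (rule C2_GDERIV) fact
  have "L (x, y) + fst D \<bullet> (p - x) \<le> L (p, y)"
    using assms(2) by (intro convex_on_above_tangent_plane GDERIV_slices[OF D])
      (simp add: convex_concave_def)
  moreover have "- L (x, y) + (- snd D) \<bullet> (q - y) \<le> - L (x, q)"
    using assms(2) GDERIV_minus[OF GDERIV_slices(2)[OF D]]
    by (intro convex_on_above_tangent_plane[where k = "\<lambda>y. - L (x, y)"])
      (simp_all add: convex_concave_def concave_on_def)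
  moreover have "regularized lam L (p, y) \<le> regularized lam L (x, q)"
    using assms(4) unfolding equilibrium_def by (meson order_trans)
  then have "L (p, y) + lam / 2 * (norm p)\<^sup>2 - lam / 2 * (norm y)\<^sup>2
      \<le> L (x, q) + lam / 2 * (norm x)\<^sup>2 - lam / 2 * (norm q)\<^sup>2"
    by (simp add: regularized_def)
  moreover have "(\<Sum>i\<in>UNIV. (x $ i - p $ i) * partial_fst (regularized lam L) i (x, y))
      = (x - p) \<bullet> (fst D + lam *\<^sub>R x)"
    unfolding partials_regularized[OF D] by (simp add: inner_vec_def)
  moreover have "(\<Sum>j\<in>UNIV. (y $ j - q $ j) * partial_snd (regularized lam L) j (x, y))
      = (y - q) \<bullet> (snd D - lam *\<^sub>R y)"
    unfolding partials_regularized[OF D] by (simp add: inner_vec_def)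
  moreover have "lam * ((x - p) \<bullet> x)
      = lam / 2 * (norm x)\<^sup>2 - lam / 2 * (norm p)\<^sup>2 + lam / 2 * (norm (x - p))\<^sup>2"
    unfolding power2_norm_eq_inner by (simp add: algebra_simps inner_commute)
  moreover have "lam * ((y - q) \<bullet> y)
      = lam / 2 * (norm y)\<^sup>2 - lam / 2 * (norm q)\<^sup>2 + lam / 2 * (norm (y - q))\<^sup>2"
    unfolding power2_norm_eq_inner by (simp add: algebra_simps inner_commute)
  ultimately show ?thesis
    by (simp add: inner_simps inner_commute algebra_simps)
qed

section \<open>Exponential convergence\<close>

lemma continuous_on_partials:
  assumes "C2 L" and "continuous_on S z"
  shows "continuous_on S (\<lambda>t. partial_fst (regularized lam L) i (z t))"
    and "continuous_on S (\<lambda>t. partial_snd (regularized lam L) j (z t))"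
proof -
  have "isCont (grad L) x" for x
    using C2_grad_derivative[OF \<open>C2 L\<close>] has_derivative_continuous by blast
  then have "continuous_on UNIV (grad L)" by (simp add: continuous_on_eq_continuous_at)
  then have "continuous_on S (\<lambda>t. grad L (z t))"
    using assms(2) by (rule continuous_on_compose2) simp
  then show "continuous_on S (\<lambda>t. partial_fst (regularized lam L) i (z t))"
    "continuous_on S (\<lambda>t. partial_snd (regularized lam L) j (z t))"
    unfolding partials_regularized[OF C2_GDERIV[OF \<open>C2 L\<close>]] using assms(2)
    by (auto intro!: continuous_intros)
qed

lemma continuous_on_blockwise:
  assumes "\<And>i. C2 (f i)" and "\<And>i. continuous_on S (\<lambda>t. block a i (\<theta> t))"
  shows "continuous_on S (\<lambda>t. blockwise a f (\<theta> t))"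
proof -
  have "continuous_on UNIV (f i)" for i
    using has_derivative_continuous[OF C2_GDERIV[OF assms(1), unfolded gderiv_def]]
    by (simp add: continuous_on_eq_continuous_at)
  then have "continuous_on S (\<lambda>t. f i (block a i (\<theta> t)))" for i
    using assms(2) by (rule continuous_on_compose2) simp
  then show ?thesis unfolding blockwise_def by (intro continuous_on_vec_lambda)
qed

theorem theorem7:
  fixes a :: "'k::finite \<Rightarrow> 'n::finite" and b :: "'l::finite \<Rightarrow> 'm::finite"
    and f :: "'n \<Rightarrow> real^'k \<Rightarrow> real" and g :: "'m \<Rightarrow> real^'l \<Rightarrow> real"
    and L :: "(real^'n) \<times> (real^'m) \<Rightarrow> real"
    and lam :: real
    and p :: "real^'n" and q :: "real^'m"
    and \<theta>0 :: "real^'k" and \<phi>0 :: "real^'l"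
  assumes "surj a" and "surj b"
    and "\<And>i. depends_on_block a i (f i)" and "\<And>j. depends_on_block b j (g j)"
    and "\<And>i. C2 (f i)" and "\<And>j. C2 (g j)" and "C2 L"
    and "\<And>i x0. \<exists>x. gradient_ascent (f i) x0 x"
    and "\<And>j x0. \<exists>x. gradient_ascent (g j) x0 x"
    and "convex_concave L" and "lam > 0"
    and "equilibrium (regularized lam L) p q"
    and "safe a b f g p q \<theta>0 \<phi>0"
  shows "\<exists>c0>0. \<exists>c1>0. \<forall>\<theta> \<phi>.
    gda_solution a b f g (regularized lam L) \<theta> \<phi> \<and> \<theta> 0 = \<theta>0 \<and> \<phi> 0 = \<phi>0 \<longrightarrow>
    (\<forall>t\<ge>0. (norm (blockwise a f (\<theta> t) - p))\<^sup>2 + (norm (blockwise b g (\<phi> t) - q))\<^sup>2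
            \<le> c0 * exp (- lam * c1 * t))"
proof -
  let ?L = "regularized lam L"
  obtain e1 where "\<forall>i. 0 \<le> e1 i" and pot1: "\<forall>E. \<exists>\<mu>>0. \<exists>M>0.
      \<forall>i. driven_energy (f i) (block a i \<theta>0) (p $ i) (e1 i) E \<mu> M"
    using safe_player_potentials[of f "\<lambda>i. block a i \<theta>0" "($) p"] assms(5,8,13)
    unfolding safe_def by auto
  obtain e2 where "\<forall>j. 0 \<le> e2 j" and pot2: "\<forall>E. \<exists>\<mu>>0. \<exists>M>0.
      \<forall>j. driven_energy (g j) (block b j \<phi>0) (q $ j) (e2 j) E \<mu> M"
    using safe_player_potentials[of g "\<lambda>j. block b j \<phi>0" "($) q"] assms(6,9,13)
    unfolding safe_def by auto
  \<comment> \<open>The total initial energy serves as the level \<open>E\<close> for both players.\<close>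
  define e where "e = (\<Sum>i\<in>UNIV. e1 i) + (\<Sum>j\<in>UNIV. e2 j)"
  have "e \<ge> 0"
    using \<open>\<forall>i. 0 \<le> e1 i\<close> \<open>\<forall>j. 0 \<le> e2 j\<close> by (simp add: e_def sum_nonneg)
  obtain \<mu>1 M1 where pos1: "\<mu>1 > 0" "M1 > 0"
    and en1: "\<forall>i. driven_energy (f i) (block a i \<theta>0) (p $ i) (e1 i) e \<mu>1 M1"
    using pot1 by blast
  obtain \<mu>2 M2 where pos2: "\<mu>2 > 0" "M2 > 0"
    and en2: "\<forall>j. driven_energy (g j) (block b j \<phi>0) (q $ j) (e2 j) e \<mu>2 M2"
    using pot2 by blast
  define \<mu> M where "\<mu> = min \<mu>1 \<mu>2" and "M = max M1 M2"
  have "\<mu> > 0" "M > 0" using pos1 pos2 by (auto simp: \<mu>_def M_def)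
  have "(norm (blockwise a f (\<theta> T) - p))\<^sup>2 + (norm (blockwise b g (\<phi> T) - q))\<^sup>2
      \<le> M * (e + 1) * exp (- lam * (\<mu> / 2) * T)"
    if sol: "gda_solution a b f g ?L \<theta> \<phi>" and init: "\<theta> 0 = \<theta>0" "\<phi> 0 = \<phi>0" and "T \<ge> 0" for \<theta> \<phi> T
  proof -
    define F G where "F t = blockwise a f (\<theta> t)" and "G t = blockwise b g (\<phi> t)" for t
    have d\<theta>: "((\<lambda>s. block a i (\<theta> s)) has_vector_derivative
        (- partial_fst ?L i (F t, G t)) *\<^sub>R grad (f i) (block a i (\<theta> t))) (at t within {0..})"
      if "t \<ge> 0" for i t
      using sol that by (simp add: gda_solution_def F_def G_def)
    have d\<phi>: "((\<lambda>s. block b j (\<phi> s)) has_vector_derivative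
        partial_snd ?L j (F t, G t) *\<^sub>R grad (g j) (block b j (\<phi> t))) (at t within {0..})"
      if "t \<ge> 0" for j t
      using sol that by (simp add: gda_solution_def F_def G_def)
    have "continuous_on {0..} (\<lambda>t. block a i (\<theta> t))" for i
      using has_vector_derivative_continuous[OF d\<theta>]
      by (simp add: continuous_on_eq_continuous_within)
    then have "continuous_on {0..} F"
      unfolding F_def by (intro continuous_on_blockwise assms(5))
    moreover have "continuous_on {0..} (\<lambda>t. block b j (\<phi> t))" for j
      using has_vector_derivative_continuous[OF d\<phi>]
      by (simp add: continuous_on_eq_continuous_within)
    then have "continuous_on {0..} G"
      unfolding G_def by (intro continuous_on_blockwise assms(6))
    ultimately have "continuous_on {0..} (\<lambda>t. (F t, G t))" by (rule continuous_on_Pair)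
    note cont = continuous_on_partials[OF \<open>C2 L\<close> this]
    obtain w1 where w1: "w1 0 = (\<Sum>i\<in>UNIV. e1 i)" and "energy_for e \<mu>1 M1
        (\<lambda>t. \<Sum>i\<in>UNIV. (f i (block a i (\<theta> t)) - p $ i) * - partial_fst ?L i (F t, G t))
        (\<lambda>t. \<Sum>i\<in>UNIV. (f i (block a i (\<theta> t)) - p $ i)\<^sup>2) w1"
      using driven_energy_sum[OF en1, of "\<lambda>i t. - partial_fst ?L i (F t, G t)" "\<lambda>i t. block a i (\<theta> t)"]
        d\<theta> continuous_on_minus[OF cont(1)] init by auto
    moreover obtain w2 where w2: "w2 0 = (\<Sum>j\<in>UNIV. e2 j)" and "energy_for e \<mu>2 M2
        (\<lambda>t. \<Sum>j\<in>UNIV. (g j (block b j (\<phi> t)) - q $ j) * partial_snd ?L j (F t, G t))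
        (\<lambda>t. \<Sum>j\<in>UNIV. (g j (block b j (\<phi> t)) - q $ j)\<^sup>2) w2"
      using driven_energy_sum[OF en2, of "\<lambda>j t. partial_snd ?L j (F t, G t)" "\<lambda>j t. block b j (\<phi> t)"]
        d\<phi> cont(2) init by auto
    ultimately have energy: "energy_for e \<mu> M
        (\<lambda>t. (\<Sum>i\<in>UNIV. (F t $ i - p $ i) * - partial_fst ?L i (F t, G t))
          + (\<Sum>j\<in>UNIV. (G t $ j - q $ j) * partial_snd ?L j (F t, G t)))
        (\<lambda>t. (\<Sum>i\<in>UNIV. (F t $ i - p $ i)\<^sup>2) + (\<Sum>j\<in>UNIV. (G t $ j - q $ j)\<^sup>2))
        (\<lambda>t. w1 t + w2 t)"
      unfolding \<mu>_def M_def by (simp add: energy_for_add F_def G_def blockwise_def)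
    have dist: "(\<Sum>i\<in>UNIV. (x $ i - y $ i)\<^sup>2) = (norm (x - y))\<^sup>2" for x y :: "real^'c::finite"
      unfolding power2_norm_eq_inner by (simp add: inner_vec_def power2_eq_square)
    have "(norm (F T - p))\<^sup>2 + (norm (G T - q))\<^sup>2 \<le> M * (w1 0 + w2 0) * exp (- (lam / 2) * \<mu> * T)"
    proof (rule exponential_decay_of_energy[OF energy[unfolded dist]])
      fix t
      show "(\<Sum>i\<in>UNIV. (F t $ i - p $ i) * - partial_fst ?L i (F t, G t))
          + (\<Sum>j\<in>UNIV. (G t $ j - q $ j) * partial_snd ?L j (F t, G t))
          \<le> - (lam / 2) * ((norm (F t - p))\<^sup>2 + (norm (G t - q))\<^sup>2)"
        using regularized_saddle_gradient_monotone[OF \<open>C2 L\<close> assms(10) less_imp_le[OF \<open>lam > 0\<close>]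
            assms(12), of "F t" "G t"]
        by (simp add: sum_negf)
    qed (use \<open>M > 0\<close> \<open>lam > 0\<close> \<open>T \<ge> 0\<close> w1 w2 in \<open>auto simp: e_def\<close>)
    also have "\<dots> \<le> M * (e + 1) * exp (- lam * (\<mu> / 2) * T)"
      using \<open>M > 0\<close> w1 w2 by (simp add: e_def)
    finally show ?thesis unfolding F_def G_def .
  qed
  \<comment> \<open>The 1 keeps the constant positive when the start is already at the equilibrium values.\<close>
  then show ?thesis
    using \<open>M > 0\<close> \<open>\<mu> > 0\<close> \<open>e \<ge> 0\<close>
    by (intro exI[of _ "M * (e + 1)"] exI[of _ "\<mu> / 2"] conjI allI impI) auto
qed

end
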